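(* Let $k$ be a field with $1/2\in k$, let $A$ be a commutative noetherian ring over $k$ and let $n\geq 1$ be an integer. The surjective map $$\Phi:\pi_0(Q_{2n})(A)\twoheadrightarrow\pi_0(\mathcal{Q}_n)(A)$$ induced by $(f_1,\ldots,f_n;g_1,\ldots,g_n;s)\mapsto(f_1,\ldots,f_n,s)$ is a bijection.
   Context: For a commutative ring $B$ over $k$, put $$Q_{2n}(B)=\left\{(f_1,\ldots,f_n;g_1,\ldots,g_n;s)\in B^{2n+1}: \sum_{i=1}^n f_ig_i+s(s-1)=0\right\},$$ $$\mathcal{Q}_n(B)=\left\{(f_1,\ldots,f_n,s)\in B^{n+1}:\ \exists\, g_1,\ldots,g_n\in B \text{ with } \sum_{i=1}^n f_ig_i+s(s-1)=0\right\}.$$ For $\mathcal F=Q_{2n}$ or $\mathcal F=\mathcal Q_n$, $\pi_0(\mathcal F)(B)$ is the pushout in sets of the two evaluation maps $\mathcal F(B[T])\to\mathcal F(B)$ at $T=0$ and $T=1$; equivalently, it is the quotient of $\mathcal F(B)$ by the equivalence relation generated by $H(0)\sim H(1)$ for $H(T)\in\mathcal F(B[T])$. *)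

theory Defs
  imports "HOL-Algebra.UnivPoly" "HOL-Algebra.Ring_Divisibility"
begin

text \<open>
  A tuple in \<open>B\<^sup>n\<close> is an element of \<open>{1..n} \<rightarrow>\<^sub>E carrier B\<close>. Such functions are
  \<open>undefined\<close> outside \<open>{1..n}\<close>, so tuples are equal iff their components are.
  Rings are commutative with unit; the zero ring is allowed.
\<close>

definition Q2n :: "nat \<Rightarrow> ('a, 'm) ring_scheme \<Rightarrow> ((nat \<Rightarrow> 'a) \<times> (nat \<Rightarrow> 'a) \<times> 'a) set"
  where "Q2n n B = {(f, g, s).
    f \<in> {1..n} \<rightarrow>\<^sub>E carrier B \<and> g \<in> {1..n} \<rightarrow>\<^sub>E carrier B \<and> s \<in> carrier B \<and>
    (\<Oplus>\<^bsub>B\<^esub>i\<in>{1..n}. f i \<otimes>\<^bsub>B\<^esub> g i) \<oplus>\<^bsub>B\<^esub> s \<otimes>\<^bsub>B\<^esub> (s \<ominus>\<^bsub>B\<^esub> \<one>\<^bsub>B\<^esub>) = \<zero>\<^bsub>B\<^esub>}"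

definition calQ :: "nat \<Rightarrow> ('a, 'm) ring_scheme \<Rightarrow> ((nat \<Rightarrow> 'a) \<times> 'a) set"
  where "calQ n B = {(f, s).
    f \<in> {1..n} \<rightarrow>\<^sub>E carrier B \<and> s \<in> carrier B \<and>
    (\<exists>g \<in> {1..n} \<rightarrow>\<^sub>E carrier B.
      (\<Oplus>\<^bsub>B\<^esub>i\<in>{1..n}. f i \<otimes>\<^bsub>B\<^esub> g i) \<oplus>\<^bsub>B\<^esub> s \<otimes>\<^bsub>B\<^esub> (s \<ominus>\<^bsub>B\<^esub> \<one>\<^bsub>B\<^esub>) = \<zero>\<^bsub>B\<^esub>)}"

definition Q2n_map :: "nat \<Rightarrow> ('a \<Rightarrow> 'b) \<Rightarrow> (nat \<Rightarrow> 'a) \<times> (nat \<Rightarrow> 'a) \<times> 'a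
    \<Rightarrow> (nat \<Rightarrow> 'b) \<times> (nat \<Rightarrow> 'b) \<times> 'b"
  where "Q2n_map n h = (\<lambda>(f, g, s). (\<lambda>i\<in>{1..n}. h (f i), \<lambda>i\<in>{1..n}. h (g i), h s))"

definition calQ_map :: "nat \<Rightarrow> ('a \<Rightarrow> 'b) \<Rightarrow> (nat \<Rightarrow> 'a) \<times> 'a \<Rightarrow> (nat \<Rightarrow> 'b) \<times> 'b"
  where "calQ_map n h = (\<lambda>(f, s). (\<lambda>i\<in>{1..n}. h (f i), h s))"

definition ev :: "('a, 'm) ring_scheme \<Rightarrow> 'a \<Rightarrow> (nat \<Rightarrow> 'a) \<Rightarrow> 'a"
  where "ev B t = UnivPoly.eval B B id t"

text \<open>Meaningful for \<open>r \<subseteq> S \<times> S\<close>; otherwise the intersection is over the empty family.\<close>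

definition generated_equiv :: "'x set \<Rightarrow> 'x rel \<Rightarrow> 'x rel"
  where "generated_equiv S r = \<Inter> {E. equiv S E \<and> r \<subseteq> E}"

definition Q2n_homotopy :: "nat \<Rightarrow> ('a, 'm) ring_scheme \<Rightarrow>
    ((nat \<Rightarrow> 'a) \<times> (nat \<Rightarrow> 'a) \<times> 'a) rel"
  where "Q2n_homotopy n B = generated_equiv (Q2n n B)
    {(Q2n_map n (ev B \<zero>\<^bsub>B\<^esub>) H, Q2n_map n (ev B \<one>\<^bsub>B\<^esub>) H) | H. H \<in> Q2n n (UP B)}"

definition calQ_homotopy :: "nat \<Rightarrow> ('a, 'm) ring_scheme \<Rightarrow> ((nat \<Rightarrow> 'a) \<times> 'a) rel"
  where "calQ_homotopy n B = generated_equiv (calQ n B)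
    {(calQ_map n (ev B \<zero>\<^bsub>B\<^esub>) H, calQ_map n (ev B \<one>\<^bsub>B\<^esub>) H) | H. H \<in> calQ n (UP B)}"

definition pi0_Q2n :: "nat \<Rightarrow> ('a, 'm) ring_scheme \<Rightarrow>
    ((nat \<Rightarrow> 'a) \<times> (nat \<Rightarrow> 'a) \<times> 'a) set set"
  where "pi0_Q2n n B = Q2n n B // Q2n_homotopy n B"

definition pi0_calQ :: "nat \<Rightarrow> ('a, 'm) ring_scheme \<Rightarrow> ((nat \<Rightarrow> 'a) \<times> 'a) set set"
  where "pi0_calQ n B = calQ n B // calQ_homotopy n B"

definition forget_g :: "(nat \<Rightarrow> 'a) \<times> (nat \<Rightarrow> 'a) \<times> 'a \<Rightarrow> (nat \<Rightarrow> 'a) \<times> 'a"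
  where "forget_g = (\<lambda>(f, g, s). (f, s))"

text \<open>
  The union is the standard form of a map induced on a quotient: if \<open>forget_g\<close> respects
  the relations, all its members are the same class.
\<close>

definition Phi :: "nat \<Rightarrow> ('a, 'm) ring_scheme \<Rightarrow>
    ((nat \<Rightarrow> 'a) \<times> (nat \<Rightarrow> 'a) \<times> 'a) set \<Rightarrow> ((nat \<Rightarrow> 'a) \<times> 'a) set"
  where "Phi n B X = (\<Union>x\<in>X. calQ_homotopy n B `` {forget_g x})"

end

theory Submission
  imports Defs
begin

text \<open>
  Surjectivity is built into the definition of \<open>\<Q>\<^sub>n\<close>: forgetting \<open>g\<close> maps \<open>Q\<^sub>2\<^sub>n(B)\<close> onto \<open>\<Q>\<^sub>n(B)\<close>
  for every commutative ring \<open>B\<close>. Injectivity rests on two observations.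

  First, for fixed \<open>f\<close> and \<open>s\<close> the equation \<open>\<Sum> f\<^sub>i g\<^sub>i = s(1 - s)\<close> is affine in \<open>g\<close>. If \<open>g\<close> and \<open>g'\<close> are
  two solutions, then \<open>(f, (1 - T) g + T g', s)\<close> lies in \<open>Q\<^sub>2\<^sub>n(A[T])\<close>, so any two points of a fibre
  of the forgetful map are joined by a single homotopy (\<open>Q2n_homotopic_in_fibre\<close>).

  Second, surjectivity for \<open>B = A[T]\<close> says that every homotopy in \<open>\<Q>\<^sub>n\<close> lifts to one in \<open>Q\<^sub>2\<^sub>n\<close>.
  Given a chain of homotopies in \<open>\<Q>\<^sub>n(A)\<close> between the images of \<open>x\<close> and \<open>y\<close>, lift each link. Successive
  lifts need not meet, but their ends lie in a common fibre and are joined by the first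
  observation, so \<open>x\<close> and \<open>y\<close> are homotopic. This gluing argument is purely set-theoretic
  (\<open>generated_equiv_iff_of_connected_fibres\<close>).
\<close>

section \<open>Quotients by generated equivalence relations\<close>

lemma generated_equiv_is_equiv:
  assumes "r \<subseteq> S \<times> S"
  shows "equiv S (generated_equiv S r)"
proof -
  have top: "equiv S (S \<times> S)"
    by (auto simp: equiv_def refl_on_def sym_def trans_def)
  have "S \<times> S \<in> {E. equiv S E \<and> r \<subseteq> E}"
    using top assms by auto
  then have sub: "generated_equiv S r \<subseteq> S \<times> S"
    unfolding generated_equiv_def by (rule Inter_lower)
  show ?thesis
  proof (rule equivI)
    show "generated_equiv S r \<subseteq> S \<times> S" by (rule sub)
    show "refl_on S (generated_equiv S r)"
      by (auto simp: generated_equiv_def equiv_def refl_on_def)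
    show "sym (generated_equiv S r)"
      by (auto simp: generated_equiv_def equiv_def sym_def)
    show "trans (generated_equiv S r)"
      unfolding generated_equiv_def equiv_def by (blast intro: transI dest: transD)
  qed
qed

lemma generated_equiv_least:
  assumes "equiv S E" and "r \<subseteq> E"
  shows "generated_equiv S r \<subseteq> E"
  using assms unfolding generated_equiv_def by blast

lemma generated_equiv_contains: "r \<subseteq> generated_equiv S r"
  unfolding generated_equiv_def by blast

text \<open>
  Connected fibres are what makes the image of an equivalence relation transitive: when
  \<open>p x = y = p x'\<close>, a chain ending in \<open>x\<close> can be continued by one starting in \<open>x'\<close>. The image of
  the relation generated by \<open>r\<close> is therefore an equivalence relation on \<open>S'\<close>, and it contains \<open>r'\<close>
  because generators lift.
\<close>

lemma generated_equiv_iff_of_connected_fibres: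
  assumes r: "r \<subseteq> S \<times> S" and r': "r' \<subseteq> S' \<times> S'"
    and surj: "p ` S = S'"
    and push: "\<And>x y. (x, y) \<in> r \<Longrightarrow> (p x, p y) \<in> r'"
    and lift: "\<And>u v. (u, v) \<in> r' \<Longrightarrow> \<exists>x y. (x, y) \<in> r \<and> p x = u \<and> p y = v"
    and fibre: "\<And>x y. x \<in> S \<Longrightarrow> y \<in> S \<Longrightarrow> p x = p y \<Longrightarrow> (x, y) \<in> generated_equiv S r"
    and x: "x \<in> S" and y: "y \<in> S"
  shows "(x, y) \<in> generated_equiv S r \<longleftrightarrow> (p x, p y) \<in> generated_equiv S' r'"
proof -
  let ?E = "generated_equiv S r" and ?E' = "generated_equiv S' r'"
  have E: "equiv S ?E" and E': "equiv S' ?E'"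
    using r r' by (auto intro: generated_equiv_is_equiv)
  have Esub: "?E \<subseteq> S \<times> S" using E by (simp add: equiv_def)
  have Esym: "\<And>a b. (a, b) \<in> ?E \<Longrightarrow> (b, a) \<in> ?E"
    using E by (auto simp: equiv_def dest: symD)
  have Etrans: "\<And>a b c. (a, b) \<in> ?E \<Longrightarrow> (b, c) \<in> ?E \<Longrightarrow> (a, c) \<in> ?E"
    using E unfolding equiv_def by (blast dest: transD)
  have "?E \<subseteq> {(a, b). a \<in> S \<and> b \<in> S \<and> (p a, p b) \<in> ?E'}" (is "_ \<subseteq> ?K")
  proof (rule generated_equiv_least)
    show "equiv S ?K"
      using E' surj unfolding equiv_def refl_on_def sym_def trans_def by blast
    show "r \<subseteq> ?K"
      using r push generated_equiv_contains[of r' S'] by blast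
  qed
  moreover have "?E' \<subseteq> {(p a, p b) | a b. (a, b) \<in> ?E}" (is "_ \<subseteq> ?I")
  proof (rule generated_equiv_least)
    show "equiv S' ?I"
    proof (rule equivI)
      show "?I \<subseteq> S' \<times> S'" using Esub surj by auto
      show "refl_on S' ?I" using fibre surj by (fastforce simp: refl_on_def)
      show "sym ?I" using Esym by (fastforce simp: sym_def)
      show "trans ?I"
      proof (rule transI)
        fix u v w assume "(u, v) \<in> ?I" "(v, w) \<in> ?I"
        then obtain a b c d where abcd: "(a, b) \<in> ?E" "(c, d) \<in> ?E"
          "u = p a" "v = p b" "v = p c" "w = p d" by auto
        then have "b \<in> S" "c \<in> S" "p b = p c" using Esub by auto
        then have "(b, c) \<in> ?E" by (rule fibre)
        then have "(a, d) \<in> ?E" using abcd Etrans by blast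
        then show "(u, w) \<in> ?I" using abcd by auto
      qed
    qed
    show "r' \<subseteq> ?I"
    proof
      fix z assume z: "z \<in> r'"
      obtain u v where uv: "z = (u, v)" by (cases z)
      then obtain a b where "(a, b) \<in> r" "p a = u" "p b = v" using z lift by blast
      then show "z \<in> ?I" using generated_equiv_contains[of r S] uv by blast
    qed
  qed
  moreover have "(x, y) \<in> ?E" if "(p x, p y) \<in> ?I"
  proof -
    from that obtain a b where ab: "(a, b) \<in> ?E" "p x = p a" "p y = p b" by auto
    then have "(x, a) \<in> ?E" "(b, y) \<in> ?E" using fibre Esub x y by auto
    then show ?thesis using ab Etrans by blast
  qed
  ultimately show ?thesis by blast
qed

lemma bij_betw_quotient:
  assumes E: "equiv S E" and E': "equiv S' E'" and surj: "p ` S = S'"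
    and iff: "\<And>x y. x \<in> S \<Longrightarrow> y \<in> S \<Longrightarrow> (x, y) \<in> E \<longleftrightarrow> (p x, p y) \<in> E'"
  shows "\<forall>x\<in>S. (\<Union>z\<in>E `` {x}. E' `` {p z}) = E' `` {p x}"
    and "bij_betw (\<lambda>X. \<Union>z\<in>X. E' `` {p z}) (S // E) (S' // E')"
proof -
  have sub: "E \<subseteq> S \<times> S" using E by (simp add: equiv_def)
  have cong: "(\<lambda>z. E' `` {p z}) respects E"
  proof (rule congruentI)
    fix y z assume yz: "(y, z) \<in> E"
    then have "(p y, p z) \<in> E'" using iff sub by blast
    then show "E' `` {p y} = E' `` {p z}" by (rule equiv_class_eq[OF E'])
  qed
  show val: "\<forall>x\<in>S. (\<Union>z\<in>E `` {x}. E' `` {p z}) = E' `` {p x}"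
    using UN_equiv_class[OF E cong] by blast
  show "bij_betw (\<lambda>X. \<Union>z\<in>X. E' `` {p z}) (S // E) (S' // E')"
    unfolding bij_betw_def
  proof
    show "inj_on (\<lambda>X. \<Union>z\<in>X. E' `` {p z}) (S // E)"
    proof (rule inj_onI)
      fix X Y
      assume X: "X \<in> S // E" and Y: "Y \<in> S // E"
        and eq: "(\<Union>z\<in>X. E' `` {p z}) = (\<Union>z\<in>Y. E' `` {p z})"
      obtain x y where xy: "x \<in> S" "X = E `` {x}" "y \<in> S" "Y = E `` {y}"
        using X Y by (auto elim!: quotientE)
      then have "E' `` {p x} = E' `` {p y}" using eq val by metis
      then have "(p x, p y) \<in> E'" using eq_equiv_class[OF _ E'] xy surj by blast
      then have "(x, y) \<in> E" using iff xy by blast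
      then show "X = Y" using xy equiv_class_eq[OF E] by blast
    qed
    show "(\<lambda>X. \<Union>z\<in>X. E' `` {p z}) ` (S // E) = S' // E'"
      using val surj by (auto simp: quotient_def image_iff)
  qed
qed

section \<open>Ring homomorphisms and convexity of fibres\<close>

lemma Q2n_map_closed:
  assumes "cring R" and "cring S" and h: "h \<in> ring_hom R S" and H: "H \<in> Q2n n R"
  shows "Q2n_map n h H \<in> Q2n n S"
proof -
  interpret h: ring_hom_cring R S h
    using assms by (auto intro!: UnivPoly.ring_hom_cringI)
  obtain f g s where fgs: "H = (f, g, s)" by (cases H)
  have f: "f \<in> {1..n} \<rightarrow> carrier R" and g: "g \<in> {1..n} \<rightarrow> carrier R" and s: "s \<in> carrier R"
    and eq: "(\<Oplus>\<^bsub>R\<^esub>i\<in>{1..n}. f i \<otimes>\<^bsub>R\<^esub> g i) \<oplus>\<^bsub>R\<^esub> s \<otimes>\<^bsub>R\<^esub> (s \<ominus>\<^bsub>R\<^esub> \<one>\<^bsub>R\<^esub>) = \<zero>\<^bsub>R\<^esub>"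
    using H fgs by (auto simp: Q2n_def)
  have "(\<Oplus>\<^bsub>S\<^esub>i\<in>{1..n}. (\<lambda>i\<in>{1..n}. h (f i)) i \<otimes>\<^bsub>S\<^esub> (\<lambda>i\<in>{1..n}. h (g i)) i)
      = (\<Oplus>\<^bsub>S\<^esub>i\<in>{1..n}. h (f i \<otimes>\<^bsub>R\<^esub> g i))"
    using f g by (intro h.S.finsum_cong') (auto simp: Pi_iff)
  also have "\<dots> = h (\<Oplus>\<^bsub>R\<^esub>i\<in>{1..n}. f i \<otimes>\<^bsub>R\<^esub> g i)"
    using f g by (subst h.hom_finsum) (auto simp: comp_def)
  finally have sum: "(\<Oplus>\<^bsub>S\<^esub>i\<in>{1..n}. (\<lambda>i\<in>{1..n}. h (f i)) i \<otimes>\<^bsub>S\<^esub> (\<lambda>i\<in>{1..n}. h (g i)) i)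
      = h (\<Oplus>\<^bsub>R\<^esub>i\<in>{1..n}. f i \<otimes>\<^bsub>R\<^esub> g i)" .
  have fg: "(\<Oplus>\<^bsub>R\<^esub>i\<in>{1..n}. f i \<otimes>\<^bsub>R\<^esub> g i) \<in> carrier R"
    using f g by (intro h.R.finsum_closed) auto
  have "h (\<Oplus>\<^bsub>R\<^esub>i\<in>{1..n}. f i \<otimes>\<^bsub>R\<^esub> g i) \<oplus>\<^bsub>S\<^esub> h s \<otimes>\<^bsub>S\<^esub> (h s \<ominus>\<^bsub>S\<^esub> \<one>\<^bsub>S\<^esub>)
      = h ((\<Oplus>\<^bsub>R\<^esub>i\<in>{1..n}. f i \<otimes>\<^bsub>R\<^esub> g i) \<oplus>\<^bsub>R\<^esub> s \<otimes>\<^bsub>R\<^esub> (s \<ominus>\<^bsub>R\<^esub> \<one>\<^bsub>R\<^esub>))"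
    using fg s by (simp add: a_minus_def)
  then show ?thesis
    unfolding fgs Q2n_map_def Q2n_def
    using f g s eq sum by auto
qed

text \<open>
  For given \<open>f\<close> and \<open>s\<close> the defining equation is affine in \<open>g\<close>, so its solution set is closed under
  affine combinations. Taking \<open>t\<close> to be a polynomial variable turns this into a straight-line
  homotopy.
\<close>

lemma Q2n_affine_combination:
  fixes R (structure)
  assumes "cring R" and G: "(f, g, s) \<in> Q2n n R" and G': "(f, g', s) \<in> Q2n n R"
    and t: "t \<in> carrier R"
  shows "(f, \<lambda>i\<in>{1..n}. (\<one> \<ominus> t) \<otimes> g i \<oplus> t \<otimes> g' i, s) \<in> Q2n n R"
proof -
  interpret cring R by fact
  have f: "f \<in> {1..n} \<rightarrow>\<^sub>E carrier R" and g: "g \<in> {1..n} \<rightarrow> carrier R"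
    and g': "g' \<in> {1..n} \<rightarrow> carrier R" and s: "s \<in> carrier R"
    and eq: "(\<Oplus>i\<in>{1..n}. f i \<otimes> g i) \<oplus> s \<otimes> (s \<ominus> \<one>) = \<zero>"
    and eq': "(\<Oplus>i\<in>{1..n}. f i \<otimes> g' i) \<oplus> s \<otimes> (s \<ominus> \<one>) = \<zero>"
    using G G' by (auto simp: Q2n_def)
  have f': "f \<in> {1..n} \<rightarrow> carrier R" using f by (auto simp: PiE_def)
  let ?c = "\<Oplus>i\<in>{1..n}. f i \<otimes> g i"
  have c: "?c \<in> carrier R" and c': "(\<Oplus>i\<in>{1..n}. f i \<otimes> g' i) \<in> carrier R"
    using f' g g' by (auto intro!: finsum_closed simp: Pi_iff)
  have same: "(\<Oplus>i\<in>{1..n}. f i \<otimes> g' i) = ?c"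
  proof -
    have d: "s \<otimes> (s \<ominus> \<one>) \<in> carrier R" using s by simp
    show ?thesis using add.right_cancel[OF d c' c] trans[OF eq' eq[symmetric]] by (rule iffD1)
  qed
  have "(\<Oplus>i\<in>{1..n}. f i \<otimes> (\<lambda>i\<in>{1..n}. (\<one> \<ominus> t) \<otimes> g i \<oplus> t \<otimes> g' i) i)
      = (\<Oplus>i\<in>{1..n}. (\<one> \<ominus> t) \<otimes> (f i \<otimes> g i) \<oplus> t \<otimes> (f i \<otimes> g' i))"
  proof (rule finsum_cong')
    show "(\<lambda>i. (\<one> \<ominus> t) \<otimes> (f i \<otimes> g i) \<oplus> t \<otimes> (f i \<otimes> g' i)) \<in> {1..n} \<rightarrow> carrier R"
      using f' g g' t by (auto simp: Pi_iff)
    fix i assume i: "i \<in> {1..n}"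
    then have "f i \<in> carrier R" "g i \<in> carrier R" "g' i \<in> carrier R"
      using f' g g' by auto
    then show "f i \<otimes> (\<lambda>i\<in>{1..n}. (\<one> \<ominus> t) \<otimes> g i \<oplus> t \<otimes> g' i) i
        = (\<one> \<ominus> t) \<otimes> (f i \<otimes> g i) \<oplus> t \<otimes> (f i \<otimes> g' i)"
      using t i by (simp add: r_distr m_lcomm)
  qed simp
  also have "\<dots> = (\<Oplus>i\<in>{1..n}. (\<one> \<ominus> t) \<otimes> (f i \<otimes> g i)) \<oplus> (\<Oplus>i\<in>{1..n}. t \<otimes> (f i \<otimes> g' i))"
    using f' g g' t by (intro finsum_addf) (auto simp: Pi_iff)
  also have "\<dots> = (\<one> \<ominus> t) \<otimes> ?c \<oplus> t \<otimes> ?c"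
    using f' g g' t same
    by (subst (1 2) finsum_rdistr[symmetric]) (auto simp: Pi_iff)
  also have "\<dots> = (\<one> \<ominus> t \<oplus> t) \<otimes> ?c"
    using t c by (simp add: l_distr)
  also have "\<dots> = ?c"
    using t c by (simp add: a_minus_def a_assoc l_neg)
  finally show ?thesis
    using f g g' s t eq by (auto simp: Q2n_def Pi_iff)
qed

lemma UP_pre_univ_prop_id:
  assumes "cring B"
  shows "UP_pre_univ_prop B B id"
proof -
  have "id \<in> ring_hom B B" by (simp add: ring_hom_def)
  then show ?thesis
    by (intro UP_pre_univ_prop.intro UP_cring.intro UnivPoly.ring_hom_cringI assms)
qed

lemma ev_ring_hom:
  assumes "cring B" and "t \<in> carrier B"
  shows "ev B t \<in> ring_hom (UP B) B"
proof -
  interpret UP_pre_univ_prop B B id "UP B"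
    using assms(1) by (rule UP_pre_univ_prop_id)
  show ?thesis
    unfolding ev_def using assms(2) by (rule eval_ring_hom)
qed

lemma ev_const:
  assumes "cring B" and "t \<in> carrier B" and "a \<in> carrier B"
  shows "ev B t (monom (UP B) a 0) = a"
proof -
  interpret UP_pre_univ_prop B B id "UP B"
    using assms(1) by (rule UP_pre_univ_prop_id)
  show ?thesis
    unfolding ev_def using assms(2,3) eval_const by simp
qed

lemma ev_variable:
  assumes "cring B" and "t \<in> carrier B"
  shows "ev B t (monom (UP B) \<one>\<^bsub>B\<^esub> 1) = t"
proof -
  interpret UP_pre_univ_prop B B id "UP B"
    using assms(1) by (rule UP_pre_univ_prop_id)
  show ?thesis
    unfolding ev_def using assms(2) eval_monom1[of t] by simp
qed

section \<open>Homotopies\<close>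

abbreviation elementary_Q2n_homotopy :: "nat \<Rightarrow> ('a, 'm) ring_scheme \<Rightarrow>
    ((nat \<Rightarrow> 'a) \<times> (nat \<Rightarrow> 'a) \<times> 'a) rel"
  where "elementary_Q2n_homotopy n B \<equiv>
    {(Q2n_map n (ev B \<zero>\<^bsub>B\<^esub>) H, Q2n_map n (ev B \<one>\<^bsub>B\<^esub>) H) | H. H \<in> Q2n n (UP B)}"

abbreviation elementary_calQ_homotopy :: "nat \<Rightarrow> ('a, 'm) ring_scheme \<Rightarrow>
    ((nat \<Rightarrow> 'a) \<times> 'a) rel"
  where "elementary_calQ_homotopy n B \<equiv>
    {(calQ_map n (ev B \<zero>\<^bsub>B\<^esub>) H, calQ_map n (ev B \<one>\<^bsub>B\<^esub>) H) | H. H \<in> calQ n (UP B)}"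

lemma forget_g_image_Q2n: "forget_g ` Q2n n B = calQ n B"
proof
  show "forget_g ` Q2n n B \<subseteq> calQ n B"
    by (auto simp: forget_g_def Q2n_def calQ_def)
  show "calQ n B \<subseteq> forget_g ` Q2n n B"
  proof
    fix y assume y: "y \<in> calQ n B"
    obtain f s where fs: "y = (f, s)" by (cases y)
    then obtain g where "(f, g, s) \<in> Q2n n B" using y by (auto simp: Q2n_def calQ_def)
    then show "y \<in> forget_g ` Q2n n B" using fs by (force simp: forget_g_def)
  qed
qed

lemma forget_g_natural: "forget_g (Q2n_map n h H) = calQ_map n h (forget_g H)"
  by (cases H) (simp add: forget_g_def Q2n_map_def calQ_map_def)

text \<open>
  Extend the two points to constant points over \<open>B[T]\<close> and take their affine combination with
  parameter \<open>T\<close>; a single elementary homotopy suffices.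
\<close>

lemma Q2n_homotopic_in_fibre:
  fixes B :: "('a, 'm) ring_scheme"
  assumes B: "cring B" and x: "x \<in> Q2n n B" and y: "y \<in> Q2n n B"
    and xy: "forget_g x = forget_g y"
  shows "(x, y) \<in> elementary_Q2n_homotopy n B"
proof -
  interpret B: cring B by fact
  interpret P: UP_cring B "UP B" by (auto intro: UP_cring.intro B)
  let ?P = "UP B" and ?C = "\<lambda>a. monom (UP B) a 0" and ?T = "monom (UP B) \<one>\<^bsub>B\<^esub> 1"
  obtain f g s g' where x_eq: "x = (f, g, s)" and y_eq: "y = (f, g', s)"
    using xy by (cases x, cases y) (auto simp: forget_g_def)
  have f: "f \<in> {1..n} \<rightarrow>\<^sub>E carrier B" and g: "g \<in> {1..n} \<rightarrow>\<^sub>E carrier B"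
    and g': "g' \<in> {1..n} \<rightarrow>\<^sub>E carrier B" and s: "s \<in> carrier B"
    using x y by (auto simp: x_eq y_eq Q2n_def)
  have C: "?C \<in> ring_hom B ?P" by (rule P.const_ring_hom)
  define H where "H = (\<lambda>i\<in>{1..n}. ?C (f i),
    \<lambda>i\<in>{1..n}. (\<one>\<^bsub>?P\<^esub> \<ominus>\<^bsub>?P\<^esub> ?T) \<otimes>\<^bsub>?P\<^esub> (\<lambda>i\<in>{1..n}. ?C (g i)) i \<oplus>\<^bsub>?P\<^esub> ?T \<otimes>\<^bsub>?P\<^esub> (\<lambda>i\<in>{1..n}. ?C (g' i)) i,
    ?C s)"
  have "(\<lambda>i\<in>{1..n}. ?C (f i), \<lambda>i\<in>{1..n}. ?C (g i), ?C s) \<in> Q2n n ?P"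
    using Q2n_map_closed[OF B P.P.is_cring C x] unfolding x_eq Q2n_map_def by simp
  moreover have "(\<lambda>i\<in>{1..n}. ?C (f i), \<lambda>i\<in>{1..n}. ?C (g' i), ?C s) \<in> Q2n n ?P"
    using Q2n_map_closed[OF B P.P.is_cring C y] unfolding y_eq Q2n_map_def by simp
  ultimately have "H \<in> Q2n n ?P"
    unfolding H_def
    by (rule Q2n_affine_combination[OF P.P.is_cring]) (rule P.monom_closed[OF B.one_closed])
  moreover have endpoint: "Q2n_map n (ev B t) H
      = (f, \<lambda>i\<in>{1..n}. (\<one>\<^bsub>B\<^esub> \<ominus>\<^bsub>B\<^esub> t) \<otimes>\<^bsub>B\<^esub> g i \<oplus>\<^bsub>B\<^esub> t \<otimes>\<^bsub>B\<^esub> g' i, s)"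
    if t: "t \<in> carrier B" for t
  proof -
    interpret e: ring_hom_cring ?P B "ev B t"
      using ev_ring_hom[OF B t] by (auto intro!: UnivPoly.ring_hom_cringI P.P.is_cring B)
    have "ev B t ((\<one>\<^bsub>?P\<^esub> \<ominus>\<^bsub>?P\<^esub> ?T) \<otimes>\<^bsub>?P\<^esub> ?C (g i) \<oplus>\<^bsub>?P\<^esub> ?T \<otimes>\<^bsub>?P\<^esub> ?C (g' i))
        = (\<one>\<^bsub>B\<^esub> \<ominus>\<^bsub>B\<^esub> t) \<otimes>\<^bsub>B\<^esub> g i \<oplus>\<^bsub>B\<^esub> t \<otimes>\<^bsub>B\<^esub> g' i" if i: "i \<in> {1..n}" for i
    proof -
      have "g i \<in> carrier B" "g' i \<in> carrier B" using g g' i by auto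
      then show ?thesis
        using ev_const[OF B t] ev_variable[OF B t] by (simp add: a_minus_def)
    qed
    moreover have "(\<lambda>i\<in>{1..n}. ev B t ((\<lambda>i\<in>{1..n}. ?C (f i)) i)) = f"
    proof
      fix i show "(\<lambda>i\<in>{1..n}. ev B t ((\<lambda>i\<in>{1..n}. ?C (f i)) i)) i = f i"
        using f ev_const[OF B t, of "f i"] by (cases "i \<in> {1..n}") (auto simp: PiE_iff extensional_def)
    qed
    ultimately show ?thesis
      using ev_const[OF B t s] by (auto simp: Q2n_map_def H_def restrict_def fun_eq_iff)
  qed
  moreover have "(\<lambda>i\<in>{1..n}. (\<one>\<^bsub>B\<^esub> \<ominus>\<^bsub>B\<^esub> \<zero>\<^bsub>B\<^esub>) \<otimes>\<^bsub>B\<^esub> g i \<oplus>\<^bsub>B\<^esub> \<zero>\<^bsub>B\<^esub> \<otimes>\<^bsub>B\<^esub> g' i) = g"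
  proof
    fix i show "(\<lambda>i\<in>{1..n}. (\<one>\<^bsub>B\<^esub> \<ominus>\<^bsub>B\<^esub> \<zero>\<^bsub>B\<^esub>) \<otimes>\<^bsub>B\<^esub> g i \<oplus>\<^bsub>B\<^esub> \<zero>\<^bsub>B\<^esub> \<otimes>\<^bsub>B\<^esub> g' i) i = g i"
    proof (cases "i \<in> {1..n}")
      case True
      then have "g i \<in> carrier B" "g' i \<in> carrier B" using g g' by auto
      then show ?thesis using True by (simp add: a_minus_def)
    next
      case False
      then show ?thesis using PiE_arb[OF g False] by (simp only: restrict_def if_False)
    qed
  qed
  moreover have "(\<lambda>i\<in>{1..n}. (\<one>\<^bsub>B\<^esub> \<ominus>\<^bsub>B\<^esub> \<one>\<^bsub>B\<^esub>) \<otimes>\<^bsub>B\<^esub> g i \<oplus>\<^bsub>B\<^esub> \<one>\<^bsub>B\<^esub> \<otimes>\<^bsub>B\<^esub> g' i) = g'"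
  proof
    fix i show "(\<lambda>i\<in>{1..n}. (\<one>\<^bsub>B\<^esub> \<ominus>\<^bsub>B\<^esub> \<one>\<^bsub>B\<^esub>) \<otimes>\<^bsub>B\<^esub> g i \<oplus>\<^bsub>B\<^esub> \<one>\<^bsub>B\<^esub> \<otimes>\<^bsub>B\<^esub> g' i) i = g' i"
    proof (cases "i \<in> {1..n}")
      case True
      then have "g i \<in> carrier B" "g' i \<in> carrier B" using g g' by auto
      then show ?thesis using True by (simp add: a_minus_def B.r_neg)
    next
      case False
      then show ?thesis using PiE_arb[OF g' False] by (simp only: restrict_def if_False)
    qed
  qed
  ultimately have "x = Q2n_map n (ev B \<zero>\<^bsub>B\<^esub>) H" "y = Q2n_map n (ev B \<one>\<^bsub>B\<^esub>) H"
    by (simp_all add: x_eq y_eq)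
  with \<open>H \<in> Q2n n ?P\<close> show ?thesis by blast
qed

theorem lemma5p2:
  fixes k :: "('k, 'm) ring_scheme" and A :: "('k, 'a, 'p) module_scheme" and n :: nat
  assumes "field k"
    and "\<one>\<^bsub>k\<^esub> \<oplus>\<^bsub>k\<^esub> \<one>\<^bsub>k\<^esub> \<in> Units k"
    and "algebra k A"
    and "noetherian_ring A"
    and "n \<ge> 1"
  shows "(\<forall>x \<in> Q2n n A. Phi n A (Q2n_homotopy n A `` {x}) = calQ_homotopy n A `` {forget_g x})
    \<and> bij_betw (Phi n A) (pi0_Q2n n A) (pi0_calQ n A)"
proof -
  have A: "cring A" using assms(3) by (simp add: algebra_def)
  interpret P: UP_cring A "UP A" by (auto intro: UP_cring.intro A)
  let ?r = "elementary_Q2n_homotopy n A" and ?r' = "elementary_calQ_homotopy n A"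
  have surj: "forget_g ` Q2n n A = calQ n A" by (rule forget_g_image_Q2n)
  have closed: "Q2n_map n (ev A t) H \<in> Q2n n A" if "t \<in> carrier A" "H \<in> Q2n n (UP A)" for t H
    using Q2n_map_closed[OF P.P.is_cring A ev_ring_hom[OF A]] that by blast
  have r: "?r \<subseteq> Q2n n A \<times> Q2n n A"
    using closed by auto
  have push: "(forget_g x, forget_g y) \<in> ?r'" if xy: "(x, y) \<in> ?r" for x y
  proof -
    obtain H where H: "H \<in> Q2n n (UP A)"
      "x = Q2n_map n (ev A \<zero>\<^bsub>A\<^esub>) H" "y = Q2n_map n (ev A \<one>\<^bsub>A\<^esub>) H"
      using xy by auto
    have "forget_g H \<in> calQ n (UP A)" using H(1) forget_g_image_Q2n by blast
    then show ?thesis unfolding H forget_g_natural by blast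
  qed
  have lift: "\<exists>x y. (x, y) \<in> ?r \<and> forget_g x = u \<and> forget_g y = v" if uv: "(u, v) \<in> ?r'" for u v
  proof -
    obtain K where K: "K \<in> calQ n (UP A)"
      "u = calQ_map n (ev A \<zero>\<^bsub>A\<^esub>) K" "v = calQ_map n (ev A \<one>\<^bsub>A\<^esub>) K"
      using uv by auto
    then obtain H where H: "H \<in> Q2n n (UP A)" "K = forget_g H"
      using forget_g_image_Q2n[of n "UP A"] by blast
    then show ?thesis using K forget_g_natural by blast
  qed
  have r': "?r' \<subseteq> calQ n A \<times> calQ n A"
  proof
    fix z assume z: "z \<in> ?r'"
    obtain u v where uv: "z = (u, v)" by (cases z)
    then obtain x y where "(x, y) \<in> ?r" "forget_g x = u" "forget_g y = v"
      using lift z by blast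
    then show "z \<in> calQ n A \<times> calQ n A" using r surj uv by blast
  qed
  have fibre: "(x, y) \<in> generated_equiv (Q2n n A) ?r"
    if "x \<in> Q2n n A" "y \<in> Q2n n A" "forget_g x = forget_g y" for x y
    by (rule subsetD[OF generated_equiv_contains Q2n_homotopic_in_fibre[OF A that]])
  have E: "equiv (Q2n n A) (Q2n_homotopy n A)"
    unfolding Q2n_homotopy_def by (rule generated_equiv_is_equiv[OF r])
  have E': "equiv (calQ n A) (calQ_homotopy n A)"
    unfolding calQ_homotopy_def by (rule generated_equiv_is_equiv[OF r'])
  have iff: "(x, y) \<in> Q2n_homotopy n A \<longleftrightarrow> (forget_g x, forget_g y) \<in> calQ_homotopy n A"
    if "x \<in> Q2n n A" "y \<in> Q2n n A" for x y
    unfolding Q2n_homotopy_def calQ_homotopy_def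
    by (rule generated_equiv_iff_of_connected_fibres[OF r r' surj push lift fibre that])
  have Phi: "Phi n A = (\<lambda>X. \<Union>z\<in>X. calQ_homotopy n A `` {forget_g z})"
    by (simp add: Phi_def fun_eq_iff)
  show ?thesis
    unfolding Phi pi0_Q2n_def pi0_calQ_def
    by (intro conjI bij_betw_quotient[OF E E' surj iff])
qed

end
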